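(* (i) Let $V$ be a right-symmetric (pre-Lie) algebra over $\Bbbk$ with operation $(x,y)\mapsto x\circ y$, and let $a(z),b(z),c(z)\in V[[z,z^{-1}]]$ be pairwise mutually local formal distributions over $V$. Then $((a\,{}_{(n)}\,b)(z),\,c(z))$ is a local pair for every $n\in\mathbb Z_+$. (ii) Under the hypotheses of (i) on $V$, $a(z)$, $b(z)$, $c(z)$, the pair $(a(z),\,(b\,{}_{(n)}\,c)(z))$ is not necessarily local; that is, there exist a right-symmetric algebra $V$ over $\Bbbk$, pairwise mutually local formal distributions $a(z),b(z),c(z)\in V[[z,z^{-1}]]$ and $n\in\mathbb Z_+$ such that $(a(z),\,(b\,{}_{(n)}\,c)(z))$ is not a local pair.
   Context: $\Bbbk$ is a field of characteristic zero and $\mathbb Z_+$ is the set of non-negative integers. A right-symmetric (pre-Lie) algebra is a $\Bbbk$-linear space $V$ with a bilinear operation $\circ$ such that for all $x,y,z\in V$ $$(x\circ y)\circ z-x\circ(y\circ z)=(x\circ z)\circ y-x\circ(z\circ y).$$ A formal distribution over $V$ is a two-sided infinite formal series $a(z)=\sum_{n\in\mathbb Z}a_nz^{-n-1}$ with $a_n\in V$; the space of these is $V[[z,z^{-1}]]$. For formal distributions $a(z),b(z)$ put $a(w)\circ b(z)=\sum_{n,m\in\mathbb Z}(a_n\circ b_m)w^{-n-1}z^{-m-1}\in V[[w,w^{-1},z,z^{-1}]]$. The ordered pair $(a(z),b(z))$ is local if there is $N\in\mathbb Z_+$ with $(a(w)\circ b(z))(w-z)^N=0$. The distributions $a(z),b(z)$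 are mutually local if both $(a(z),b(z))$ and $(b(z),a(z))$ are local pairs; "pairwise mutually local" means each two of the given distributions are mutually local. For $n\in\mathbb Z_+$, the $n$-product is $(a\,{}_{(n)}\,b)(z)=\mathrm{Res}_{w=0}\,(a(w)\circ b(z))(w-z)^n$, where $\mathrm{Res}_{w=0}$ is the coefficient at $w^{-1}$; explicitly, its coefficient of $z^{-m-1}$ is $\sum_{s\ge 0}(-1)^s\binom ns a_{n-s}\circ b_{m+s}$. *)

theory Defs
  imports Complex_Main "HOL-Library.Poly_Mapping"
begin

locale right_symmetric_algebra = vector_space scale
  for scale :: "'k::field_char_0 \<Rightarrow> 'v::ab_group_add \<Rightarrow> 'v" +
  fixes circ :: "'v \<Rightarrow> 'v \<Rightarrow> 'v"
  assumes linear_circ_left: "Vector_Spaces.linear scale scale (\<lambda>x. circ x y)"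
    and linear_circ_right: "Vector_Spaces.linear scale scale (circ x)"
    and right_symmetric:
      "circ (circ x y) z - circ x (circ y z) = circ (circ x z) y - circ x (circ z y)"

text \<open>
  A distribution \<open>a(z)\<close> is encoded by its modes: \<open>a n\<close> is the coefficient of \<open>z\<close> to the
  power \<open>-n-1\<close>. Likewise \<open>F n m\<close> is the coefficient of \<open>w\<close> to the power \<open>-n-1\<close> times \<open>z\<close>
  to the power \<open>-m-1\<close> in the two-variable distribution \<open>F(w,z)\<close>.
\<close>

type_synonym 'v distr = "int \<Rightarrow> 'v"
type_synonym 'v distr2 = "int \<Rightarrow> int \<Rightarrow> 'v"

definition distr_circ :: "('v \<Rightarrow> 'v \<Rightarrow> 'v) \<Rightarrow> 'v distr \<Rightarrow> 'v distr \<Rightarrow> 'v distr2" where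
  "distr_circ circ a b = (\<lambda>n m. circ (a n) (b m))"

text \<open>
  Multiplication by \<open>w - z\<close>: in the mode indexing above, multiplying by \<open>w\<close> (by \<open>z\<close>) moves the
  mode \<open>n + 1\<close> (the mode \<open>m + 1\<close>) to \<open>n\<close> (to \<open>m\<close>).
\<close>

definition mult_w_minus_z :: "'v::ab_group_add distr2 \<Rightarrow> 'v distr2" where
  "mult_w_minus_z F = (\<lambda>n m. F (n + 1) m - F n (m + 1))"

text \<open>The coefficient at \<open>w\<close> to the power \<open>-1\<close> is the mode \<open>0\<close>.\<close>

definition residue_w :: "'v distr2 \<Rightarrow> 'v distr" where
  "residue_w F = F 0"

definition local_pair ::
    "('v \<Rightarrow> 'v \<Rightarrow> 'v) \<Rightarrow> 'v::ab_group_add distr \<Rightarrow> 'v distr \<Rightarrow> bool" where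
  "local_pair circ a b \<longleftrightarrow>
     (\<exists>N. (mult_w_minus_z ^^ N) (distr_circ circ a b) = (\<lambda>n m. 0))"

definition mutually_local ::
    "('v \<Rightarrow> 'v \<Rightarrow> 'v) \<Rightarrow> 'v::ab_group_add distr \<Rightarrow> 'v distr \<Rightarrow> bool" where
  "mutually_local circ a b \<longleftrightarrow> local_pair circ a b \<and> local_pair circ b a"

definition n_product ::
    "('v \<Rightarrow> 'v \<Rightarrow> 'v) \<Rightarrow> nat \<Rightarrow> 'v::ab_group_add distr \<Rightarrow> 'v distr \<Rightarrow> 'v distr" where
  "n_product circ n a b = residue_w ((mult_w_minus_z ^^ n) (distr_circ circ a b))"

lemma (in right_symmetric_algebra) mult_w_minus_z_power:
  "(mult_w_minus_z ^^ N) F n m =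
     (\<Sum>s\<le>N. scale ((- 1) ^ s * of_nat (N choose s)) (F (n + int N - int s) (m + int s)))"
proof (induction N arbitrary: n m)
  case 0
  show ?case by simp
next
  case (Suc N)
  define t where "t s = F (n + 1 + int N - int s) (m + int s)" for s
  have 1: "(mult_w_minus_z ^^ N) F (n + 1) m =
      (\<Sum>s\<le>Suc N. scale ((- 1) ^ s * of_nat (N choose s)) (t s))"
    by (simp add: Suc t_def)
  have 2: "(mult_w_minus_z ^^ N) F n (m + 1) =
      (\<Sum>s\<le>N. scale ((- 1) ^ s * of_nat (N choose s)) (t (Suc s)))"
    by (simp add: Suc t_def algebra_simps)
  have "(\<Sum>s\<le>Suc N. scale ((- 1) ^ s * of_nat (Suc N choose s)) (t s)) =
      scale 1 (t 0) + (\<Sum>s\<le>N. scale ((- 1) ^ Suc s * of_nat (N choose Suc s)) (t (Suc s)))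
      - (\<Sum>s\<le>N. scale ((- 1) ^ s * of_nat (N choose s)) (t (Suc s)))"
    unfolding sum.atMost_Suc_shift
    by (simp add: sum_negf sum.distrib sum_subtractf scale_left_distrib
        scale_left_diff_distrib algebra_simps)
  also have "\<dots> = (mult_w_minus_z ^^ N) F (n + 1) m - (mult_w_minus_z ^^ N) F n (m + 1)"
    unfolding 1 2 sum.atMost_Suc_shift by simp
  also have "\<dots> = (mult_w_minus_z ^^ Suc N) F n m"
    by (simp add: mult_w_minus_z_def)
  finally show ?case by (simp add: t_def algebra_simps)
qed

lemma (in right_symmetric_algebra) n_product_explicit:
  "n_product circ n a b m =
     (\<Sum>s\<le>n. scale ((- 1) ^ s * of_nat (n choose s)) (circ (a (int n - int s)) (b (m + int s))))"
  by (simp add: n_product_def residue_w_def mult_w_minus_z_power distr_circ_def)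

text \<open>
  An existential claim about right-symmetric algebras over \<open>'k\<close> has to name a carrier type; we
  use \<open>nat \<Rightarrow>\<^sub>0 'k\<close>, of countably infinite dimension. For statements about finitely many
  distributions this loses nothing: the subalgebra generated by their modes has countable
  dimension, and adding a direct summand with zero product makes it countably infinite.
\<close>

end

theory Submission
  imports Defs "HOL-Library.Function_Algebras"
begin

text \<open>
  (i) Work in three variables and put \<open>F(w,u,z) = (a(w) \<circ> b(u)) \<circ> c(z)\<close>. Right symmetry gives
  \<open>F = a(w) \<circ> (b(u) \<circ> c(z)) - a(w) \<circ> (c(z) \<circ> b(u)) + (a(w) \<circ> c(z)) \<circ> b(u)\<close>.
  A power \<open>(u-z)^M\<close> kills the first two terms and a power \<open>(w-z)^K\<close> kills the third, so
  \<open>(u-z)^M (w-z)^K F = 0\<close>; this is where locality of both \<open>(b,c)\<close> and \<open>(c,b)\<close> enters.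
  Locality of \<open>(a,b)\<close> gives \<open>(w-u)^L F = 0\<close>.
  Since \<open>u - z = (w - z) - (w - u)\<close>, every term of the expansion of \<open>(u-z)^(K+L)\<close> contains
  \<open>(w-z)^K\<close> or \<open>(w-u)^L\<close>, whence \<open>(u-z)^(M+K+L) F = 0\<close>. Multiplying by \<open>(w-u)^n\<close> and
  taking the residue in \<open>w\<close>, neither of which interferes with \<open>u - z\<close>, yields locality of
  \<open>a (n) b\<close> with \<open>c\<close> (\<open>local_pair_n_product\<close>).

  (ii) Right symmetry constrains \<open>a \<circ> (b \<circ> c)\<close> only through its difference with
  \<open>a \<circ> (c \<circ> b)\<close>, so a product \<open>b \<circ> b\<close> may act on \<open>a\<close> from the right in any way even if
  \<open>a \<circ> b = b \<circ> a = 0\<close>. In the three-dimensional algebra with basis \<open>a, b, d\<close> and nonzero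
  products \<open>b \<circ> b = d\<close> and \<open>a \<circ> d = a\<close>, take \<open>a(z) = a z^(-1)\<close> and let every mode of
  \<open>b(z) = c(z)\<close> be \<open>b\<close>. All locality hypotheses hold, but every mode of \<open>b (0) b\<close> is
  \<open>d\<close>, and \<open>a w^(-1) (\<Sum>m. z^m)\<close> is killed by no power of \<open>w - z\<close>: multiplication by
  \<open>(w-z)^N\<close> leaves \<open>a w^(N-1) (\<Sum>m. z^m)\<close> among terms of smaller degree in \<open>w\<close>.
\<close>

section \<open>Commuting operators\<close>

lemma funpow_commute_apply:
  assumes "\<And>x. P (Q x) = Q (P x)"
  shows "(P ^^ i) ((Q ^^ j) x) = (Q ^^ j) ((P ^^ i) x)"
proof -
  have "P ((Q ^^ j) x) = (Q ^^ j) (P x)" for x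
    by (induction j) (simp_all add: assms)
  then show ?thesis
    by (induction i) simp_all
qed

lemma additive_funpow:
  fixes P :: "'g::ab_group_add \<Rightarrow> 'g"
  assumes "additive P"
  shows "additive (P ^^ i)"
  using assms by (induction i) (simp_all add: additive_def)

lemma funpow_diff_eq_0:
  fixes g :: "'g::ab_group_add"
  assumes P: "additive P" and Q: "additive Q" and R: "\<And>x. R x = P x - Q x"
    and comm: "\<And>x. P (Q x) = Q (P x)"
    and "(P ^^ K) g = 0" and "(Q ^^ L) g = 0"
  shows "(R ^^ (K + L)) g = 0"
proof -
  have "additive R"
    using additive.add[OF P] additive.add[OF Q] by (simp add: additive_def R algebra_simps)
  then have zero: "(R ^^ i) 0 = 0" and diff: "(R ^^ i) (x - y) = (R ^^ i) x - (R ^^ i) y"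
    for i x y
    using additive_funpow[of R] by (simp_all add: additive.zero additive.diff)
  \<comment> \<open>Instead of expanding \<open>(P - Q)^(K+L)\<close>, peel off one factor: applying \<open>P\<close> to \<open>g\<close> lowers
    \<open>K\<close>, applying \<open>Q\<close> lowers \<open>L\<close>, and each preserves the other hypothesis.\<close>
  show ?thesis
    using assms(5,6)
  proof (induction "K + L" arbitrary: K L g)
    case 0
    then show ?case by simp
  next
    case (Suc n)
    show ?case
    proof (cases "K = 0 \<or> L = 0")
      case True
      then have "g = 0" using Suc.prems by auto
      then show ?thesis by (simp add: zero)
    next
      case False
      then obtain K' L' where K: "K = Suc K'" and L: "L = Suc L'"
        by (metis not0_implies_Suc)
      have PQ: "(Q ^^ L) (P g) = P ((Q ^^ L) g)" "(P ^^ K) (Q g) = Q ((P ^^ K) g)"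
        using funpow_commute_apply[of P Q 1 L] funpow_commute_apply[of P Q K 1] comm by simp_all
      have "(R ^^ (K' + L)) (P g) = 0"
      proof (rule Suc.hyps(1))
        show "n = K' + L" using Suc.hyps(2) K by simp
        show "(P ^^ K') (P g) = 0"
          using Suc.prems(1) by (simp add: K funpow_swap1)
        show "(Q ^^ L) (P g) = 0"
          using PQ Suc.prems(2) by (simp add: additive.zero[OF P])
      qed
      moreover have "(R ^^ (K + L')) (Q g) = 0"
      proof (rule Suc.hyps(1))
        show "n = K + L'" using Suc.hyps(2) L by simp
        show "(Q ^^ L') (Q g) = 0"
          using Suc.prems(2) by (simp add: L funpow_swap1)
        show "(P ^^ K) (Q g) = 0"
          using PQ Suc.prems(1) by (simp add: additive.zero[OF Q])
      qed
      moreover have "(R ^^ (K + L)) g = (R ^^ n) (P g - Q g)"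
        unfolding Suc.hyps(2)[symmetric] by (simp add: funpow_swap1 R)
      ultimately show ?thesis
        using Suc.hyps(2) K L by (simp add: diff)
    qed
  qed
qed

section \<open>Powers of differences of variables\<close>

lemma additive_mult_w_minus_z: "additive mult_w_minus_z"
  by (auto simp: additive_def mult_w_minus_z_def fun_eq_iff)

lemma mult_w_minus_z_funpow_map:
  assumes "additive f"
  shows "(mult_w_minus_z ^^ N) (\<lambda>n m. f (G n m)) = (\<lambda>n m. f ((mult_w_minus_z ^^ N) G n m))"
  using additive.diff[OF assms] by (induction N) (simp_all add: mult_w_minus_z_def)

text \<open>Exchanging the two variables only changes the sign of \<open>w - z\<close>.\<close>

lemma mult_w_minus_z_funpow_swap_eq_0:
  assumes "(mult_w_minus_z ^^ N) G = 0"
  shows "(mult_w_minus_z ^^ N) (\<lambda>n m. G m n) = 0"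
  using assms
proof (induction N arbitrary: G)
  case 0
  then show ?case by (simp add: fun_eq_iff)
next
  case (Suc N)
  let ?H = "\<lambda>n m. mult_w_minus_z G m n"
  have "(mult_w_minus_z ^^ N) ?H = 0"
    using Suc.IH[of "mult_w_minus_z G"] Suc.prems by (simp only: funpow_Suc_right comp_apply)
  have "mult_w_minus_z (\<lambda>n m. G m n) = - ?H"
    by (simp add: mult_w_minus_z_def fun_eq_iff)
  then have "(mult_w_minus_z ^^ Suc N) (\<lambda>n m. G m n) = (mult_w_minus_z ^^ N) (- ?H)"
    by (simp only: funpow_Suc_right comp_apply)
  also have "\<dots> = - (mult_w_minus_z ^^ N) ?H"
    by (rule additive.minus[OF additive_funpow[OF additive_mult_w_minus_z]])
  also have "\<dots> = 0"
    unfolding \<open>(mult_w_minus_z ^^ N) ?H = 0\<close> by (rule minus_zero)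
  finally show ?case .
qed

text \<open>
  The arguments of \<open>F\<close> are the modes of \<open>w\<close>, \<open>u\<close> and \<open>z\<close>, in this order. Keeping every
  operator a two-variable multiplication in a pair of slots lets locality of pairs be
  transferred slice by slice.
\<close>

type_synonym 'v distr3 = "int \<Rightarrow> int \<Rightarrow> int \<Rightarrow> 'v"

definition mult_w_minus_u :: "'v::ab_group_add distr3 \<Rightarrow> 'v distr3" where
  "mult_w_minus_u F = (\<lambda>n m k. mult_w_minus_z (\<lambda>n m. F n m k) n m)"

definition mult3_w_minus_z :: "'v::ab_group_add distr3 \<Rightarrow> 'v distr3" where
  "mult3_w_minus_z F = (\<lambda>n m k. mult_w_minus_z (\<lambda>n k. F n m k) n k)"

definition mult_u_minus_z :: "'v::ab_group_add distr3 \<Rightarrow> 'v distr3" where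
  "mult_u_minus_z F = (\<lambda>n. mult_w_minus_z (F n))"

lemmas mult3_defs = mult_w_minus_u_def mult3_w_minus_z_def mult_u_minus_z_def mult_w_minus_z_def

lemma additive_mult3:
  "additive mult_w_minus_u" "additive mult3_w_minus_z" "additive mult_u_minus_z"
  by (auto simp: additive_def mult3_defs fun_eq_iff)

lemma mult3_commute:
  "mult3_w_minus_z (mult_w_minus_u F) = mult_w_minus_u (mult3_w_minus_z F)"
  "mult3_w_minus_z (mult_u_minus_z F) = mult_u_minus_z (mult3_w_minus_z F)"
  "mult_u_minus_z (mult_w_minus_u F) = mult_w_minus_u (mult_u_minus_z F)"
  by (auto simp: mult3_defs fun_eq_iff)

lemma mult_u_minus_z_eq_diff: "mult_u_minus_z F = mult3_w_minus_z F - mult_w_minus_u F"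
  by (auto simp: mult3_defs fun_eq_iff)

lemma mult_w_minus_u_funpow:
  "(mult_w_minus_u ^^ N) F = (\<lambda>n m k. (mult_w_minus_z ^^ N) (\<lambda>n m. F n m k) n m)"
  by (induction N) (simp_all add: mult_w_minus_u_def)

lemma mult3_w_minus_z_funpow:
  "(mult3_w_minus_z ^^ N) F = (\<lambda>n m k. (mult_w_minus_z ^^ N) (\<lambda>n k. F n m k) n k)"
  by (induction N) (simp_all add: mult3_w_minus_z_def)

lemma mult_u_minus_z_funpow:
  "(mult_u_minus_z ^^ N) F = (\<lambda>n. (mult_w_minus_z ^^ N) (F n))"
  by (induction N) (simp_all add: mult_u_minus_z_def)

text \<open>
  To be applied to \<open>F = (a \<circ> b) \<circ> c\<close>, with \<open>C = (a \<circ> c) \<circ> b\<close> and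
  \<open>A = a \<circ> (b \<circ> c) - a \<circ> (c \<circ> b)\<close>. Multiplication by \<open>(u-z)^M\<close> removes \<open>A\<close>; what
  remains of \<open>F\<close> is killed by powers of both \<open>w - z\<close> and \<open>w - u\<close>, hence by a power of
  their difference \<open>u - z\<close>.
\<close>

lemma mult_u_minus_z_funpow_eq_0:
  assumes "F = A + C"
    and A: "(mult_u_minus_z ^^ M) A = 0"
    and C: "(mult3_w_minus_z ^^ K) C = 0"
    and F: "(mult_w_minus_u ^^ L) F = 0"
  shows "(mult_u_minus_z ^^ (K + L + M)) F = 0"
proof -
  note add = additive_mult3[THEN additive_funpow]
  let ?G = "(mult_u_minus_z ^^ M) F"
  have "(mult3_w_minus_z ^^ K) ?G = (mult_u_minus_z ^^ M) ((mult3_w_minus_z ^^ K) C)"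
    using funpow_commute_apply[of mult3_w_minus_z mult_u_minus_z K M C, OF mult3_commute(2)]
    by (simp add: assms(1) add[THEN additive.add] A)
  then have "(mult3_w_minus_z ^^ K) ?G = 0"
    by (simp add: C add[THEN additive.zero])
  moreover have "(mult_w_minus_u ^^ L) ?G = 0"
    using funpow_commute_apply[of mult_u_minus_z mult_w_minus_u M L F, OF mult3_commute(3)]
    by (simp add: F add[THEN additive.zero])
  ultimately have "(mult_u_minus_z ^^ (K + L)) ?G = 0"
    by (intro funpow_diff_eq_0[where P = mult3_w_minus_z and Q = mult_w_minus_u]
        additive_mult3 mult_u_minus_z_eq_diff mult3_commute)
  then show ?thesis
    by (simp add: funpow_add)
qed

section \<open>Locality of products on the left\<close>

context right_symmetric_algebra
begin

lemma additive_circ: "additive (circ x)" "additive (\<lambda>x. circ x y)"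
  using linear_circ_left linear_circ_right
  by (simp_all add: additive_def Vector_Spaces.linear_def module_hom_def module_hom_axioms_def)

theorem local_pair_n_product:
  assumes "local_pair circ a b" and "local_pair circ a c"
    and "local_pair circ b c" and "local_pair circ c b"
  shows "local_pair circ (n_product circ n a b) c"
proof -
  let ?M = mult_w_minus_z
  obtain L K M1 M2 where ab: "(?M ^^ L) (\<lambda>i j. circ (a i) (b j)) = 0"
    and ac: "(?M ^^ K) (\<lambda>i j. circ (a i) (c j)) = 0"
    and bc: "(?M ^^ M1) (\<lambda>i j. circ (b i) (c j)) = 0"
    and cb: "(?M ^^ M2) (\<lambda>i j. circ (c i) (b j)) = 0"
    using assms unfolding local_pair_def distr_circ_def zero_fun_def by blast
  define F where "F = (\<lambda>i j k. circ (circ (a i) (b j)) (c k))"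
  define A1 where "A1 = (\<lambda>i j k. circ (a i) (circ (b j) (c k)))"
  define A2 where "A2 = (\<lambda>i j k. circ (a i) (circ (c k) (b j)))"
  define C where "C = (\<lambda>i j k. circ (circ (a i) (c k)) (b j))"
  note add = additive_mult3[THEN additive_funpow]
  have "F i j k = (A1 - A2 + C) i j k" for i j k
    using right_symmetric[of "a i" "b j" "c k"]
    by (simp add: F_def A1_def A2_def C_def algebra_simps)
  then have "F = A1 - A2 + C"
    by blast
  moreover have "(mult_u_minus_z ^^ (M1 + M2)) (A1 - A2) = 0"
  proof -
    have "(mult_u_minus_z ^^ M1) A1 = 0"
      by (simp add: A1_def mult_u_minus_z_funpow bc
          mult_w_minus_z_funpow_map[OF additive_circ(1), of M1 _ "\<lambda>j k. circ (b j) (c k)"]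
          additive.zero[OF additive_circ(1)] fun_eq_iff)
    moreover have "(mult_u_minus_z ^^ M2) A2 = 0"
      using mult_w_minus_z_funpow_swap_eq_0[OF cb]
      by (simp add: A2_def mult_u_minus_z_funpow
          mult_w_minus_z_funpow_map[OF additive_circ(1), of M2 _ "\<lambda>j k. circ (c k) (b j)"]
          additive.zero[OF additive_circ(1)] fun_eq_iff)
    moreover have "(mult_u_minus_z ^^ (M1 + M2)) A1
        = (mult_u_minus_z ^^ M2) ((mult_u_minus_z ^^ M1) A1)"
      by (metis add.commute comp_apply funpow_add)
    ultimately show ?thesis
      by (simp add: add[THEN additive.diff] funpow_add add[THEN additive.zero])
  qed
  moreover have "(mult3_w_minus_z ^^ K) C = 0"
    using mult_w_minus_z_funpow_map[OF additive_circ(2), of K "\<lambda>i j. circ (a i) (c j)"]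
    by (simp add: C_def mult3_w_minus_z_funpow ac additive.zero[OF additive_circ(2)] fun_eq_iff)
  moreover have F_power: "(mult_w_minus_u ^^ N) F
      = (\<lambda>i j k. circ ((?M ^^ N) (\<lambda>i j. circ (a i) (b j)) i j) (c k))" for N
    using mult_w_minus_z_funpow_map[OF additive_circ(2), of N "\<lambda>i j. circ (a i) (b j)"]
    by (simp add: F_def mult_w_minus_u_funpow fun_eq_iff)
  then have "(mult_w_minus_u ^^ L) F = 0"
    by (simp add: ab additive.zero[OF additive_circ(2)] fun_eq_iff)
  ultimately have zero: "(mult_u_minus_z ^^ (K + L + (M1 + M2))) F = 0"
    by (intro mult_u_minus_z_funpow_eq_0)
  \<comment> \<open>The residue in \<open>w\<close> of \<open>(w-u)^n F\<close> is its slice at mode \<open>0\<close> of the first variable.\<close>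
  have slice: "distr_circ circ (n_product circ n a b) c = (mult_w_minus_u ^^ n) F 0"
    by (simp add: F_power distr_circ_def n_product_def residue_w_def)
  have "(?M ^^ (K + L + (M1 + M2))) ((mult_w_minus_u ^^ n) F 0)
      = (mult_u_minus_z ^^ (K + L + (M1 + M2))) ((mult_w_minus_u ^^ n) F) 0"
    by (simp add: mult_u_minus_z_funpow)
  also have "\<dots> = 0"
    using funpow_commute_apply[of mult_u_minus_z mult_w_minus_u _ n F, OF mult3_commute(3)]
    by (simp add: zero add[THEN additive.zero])
  finally show ?thesis
    unfolding local_pair_def slice zero_fun_def by blast
qed

end

section \<open>A non-local product on the right\<close>

definition pm_scale :: "'k::field_char_0 \<Rightarrow> (nat \<Rightarrow>\<^sub>0 'k) \<Rightarrow> (nat \<Rightarrow>\<^sub>0 'k)" where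
  "pm_scale r = Poly_Mapping.map ((*) r)"

text \<open>
  The basis vectors \<open>0\<close>, \<open>1\<close>, \<open>2\<close> are \<open>a\<close>, \<open>b\<close>, \<open>d\<close> with \<open>b \<circ> b = d\<close> and \<open>a \<circ> d = a\<close>;
  all other basis vectors only fill up the carrier and annihilate everything.
\<close>

definition cex_circ :: "(nat \<Rightarrow>\<^sub>0 'k::field_char_0) \<Rightarrow> (nat \<Rightarrow>\<^sub>0 'k) \<Rightarrow> (nat \<Rightarrow>\<^sub>0 'k)" where
  "cex_circ x y =
     Poly_Mapping.single 0 (Poly_Mapping.lookup x 0 * Poly_Mapping.lookup y 2)
     + Poly_Mapping.single 2 (Poly_Mapping.lookup x 1 * Poly_Mapping.lookup y 1)"

lemma lookup_pm_scale: "Poly_Mapping.lookup (pm_scale r x) i = r * Poly_Mapping.lookup x i"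
  by (simp add: pm_scale_def map.rep_eq when_def)

lemma lookup_cex_circ:
  "Poly_Mapping.lookup (cex_circ x y) i =
     (if i = 0 then Poly_Mapping.lookup x 0 * Poly_Mapping.lookup y 2
      else if i = 2 then Poly_Mapping.lookup x 1 * Poly_Mapping.lookup y 1 else 0)"
  by (simp add: cex_circ_def lookup_add lookup_single when_def)

lemma vector_space_pm_scale: "vector_space pm_scale"
  by unfold_locales
    (auto intro!: poly_mapping_eqI simp: lookup_pm_scale lookup_add algebra_simps)

lemma right_symmetric_algebra_cex: "right_symmetric_algebra pm_scale cex_circ"
proof -
  have hom: "Vector_Spaces.linear pm_scale pm_scale f"
    if "\<And>x y. f (x + y) = f x + f y" "\<And>r x. f (pm_scale r x) = pm_scale r (f x)" for f
    using vector_space_pm_scale that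
    by (simp add: Vector_Spaces.linear_def module_hom_def module_hom_axioms_def
        vector_space_def module_def)
  show ?thesis
    unfolding right_symmetric_algebra_def right_symmetric_algebra_axioms_def
    by (intro conjI allI vector_space_pm_scale hom)
      (auto intro!: poly_mapping_eqI
        simp: lookup_cex_circ lookup_pm_scale lookup_add lookup_minus algebra_simps)
qed

definition cex_a :: "(nat \<Rightarrow>\<^sub>0 'k::field_char_0) distr" where
  "cex_a n = (if n = 0 then Poly_Mapping.single 0 1 else 0)"

definition cex_b :: "(nat \<Rightarrow>\<^sub>0 'k::field_char_0) distr" where
  "cex_b n = Poly_Mapping.single 1 1"

lemma mutually_local_cex_a_b:
  "mutually_local cex_circ cex_a (cex_b :: (nat \<Rightarrow>\<^sub>0 'k::field_char_0) distr)"
proof -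
  have "cex_circ (cex_a n) (cex_b m :: nat \<Rightarrow>\<^sub>0 'k) = 0"
    "cex_circ (cex_b m) (cex_a n :: nat \<Rightarrow>\<^sub>0 'k) = 0" for n m
    by (auto intro!: poly_mapping_eqI
        simp: lookup_cex_circ cex_a_def cex_b_def lookup_single lookup_one when_def)
  then show ?thesis
    unfolding mutually_local_def local_pair_def distr_circ_def
    by (intro conjI exI[of _ 0]) simp_all
qed

lemma mutually_local_cex_b_b: "mutually_local cex_circ cex_b cex_b"
  unfolding mutually_local_def local_pair_def distr_circ_def
  by (intro conjI exI[of _ 1]) (simp_all add: mult_w_minus_z_def cex_b_def)

lemma not_local_pair_cex: "\<not> local_pair cex_circ cex_a (n_product cex_circ 0 cex_b cex_b)"
proof -
  let ?F = "distr_circ cex_circ cex_a (n_product cex_circ 0 cex_b cex_b)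
    :: (nat \<Rightarrow>\<^sub>0 'a::field_char_0) distr2"
  have F: "?F = (\<lambda>n m. cex_a n)"
    by (auto intro!: poly_mapping_eqI simp: fun_eq_iff distr_circ_def n_product_def
        residue_w_def lookup_cex_circ cex_a_def cex_b_def lookup_single lookup_one when_def)
  \<comment> \<open>The top degree in \<open>w\<close> of \<open>(w-z)^N a w^(-1)\<close> comes from \<open>w^N\<close> alone, with coefficient \<open>1\<close>.\<close>
  have top: "n + int N \<le> 0 \<Longrightarrow> (mult_w_minus_z ^^ N) ?F n m = cex_a (n + int N)" for N n m
  proof (induction N arbitrary: n m)
    case 0
    then show ?case by (simp add: F)
  next
    case (Suc N)
    have "(mult_w_minus_z ^^ N) ?F (n + 1) m = cex_a (n + 1 + int N)"
      and "(mult_w_minus_z ^^ N) ?F n (m + 1) = cex_a (n + int N)"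
      using Suc.prems by (simp_all add: Suc.IH)
    then show ?case
      using Suc.prems by (simp add: mult_w_minus_z_def[of "(mult_w_minus_z ^^ N) G" for G]
          cex_a_def[of "n + int N"] add_ac)
  qed
  have "(mult_w_minus_z ^^ N) ?F (- int N) 0 \<noteq> 0" for N
    by (simp add: top cex_a_def)
  then show ?thesis
    unfolding local_pair_def by metis
qed

theorem theorem3:
  "(\<forall>(scale :: 'k::field_char_0 \<Rightarrow> 'v::ab_group_add \<Rightarrow> 'v) circ a b c.
      right_symmetric_algebra scale circ \<longrightarrow>
      mutually_local circ a b \<longrightarrow> mutually_local circ a c \<longrightarrow> mutually_local circ b c \<longrightarrow>
      (\<forall>n. local_pair circ (n_product circ n a b) c)) \<and>
   (\<exists>(scale :: 'k \<Rightarrow> (nat \<Rightarrow>\<^sub>0 'k) \<Rightarrow> (nat \<Rightarrow>\<^sub>0 'k)) circ a b c n.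
      right_symmetric_algebra scale circ \<and>
      mutually_local circ a b \<and> mutually_local circ a c \<and> mutually_local circ b c \<and>
      \<not> local_pair circ a (n_product circ n b c))"
proof (intro conjI allI impI)
  fix scale :: "'k \<Rightarrow> 'v \<Rightarrow> 'v" and circ a b c n
  assume "right_symmetric_algebra scale circ"
    and "mutually_local circ a b" "mutually_local circ a c" "mutually_local circ b c"
  then show "local_pair circ (n_product circ n a b) c"
    by (simp add: right_symmetric_algebra.local_pair_n_product mutually_local_def)
next
  show "\<exists>(scale :: 'k \<Rightarrow> (nat \<Rightarrow>\<^sub>0 'k) \<Rightarrow> (nat \<Rightarrow>\<^sub>0 'k)) circ a b c n.
      right_symmetric_algebra scale circ \<and>
      mutually_local circ a b \<and> mutually_local circ a c \<and> mutually_local circ b c \<and>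
      \<not> local_pair circ a (n_product circ n b c)"
    using right_symmetric_algebra_cex mutually_local_cex_a_b mutually_local_cex_b_b
      not_local_pair_cex
    by blast
qed

end
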